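(* For all positive integers $k\leq n$ and every $\tau\in T_k^1$, $$|S_n(T_k^1;\tau)|=(n+1-k)\cdot(k-1)^{n-k}.$$
   Context: $S_n$ denotes the set of all permutations $\alpha=(\alpha_1,\dots,\alpha_n)$ of $\{1,\dots,n\}$, written in one-line notation. For $1\leq m\leq k$, $T_k^m=\{\sigma\in S_k\mid\sigma_1=m\}$ is the set of permutations of $\{1,\dots,k\}$ whose first entry is $m$. An occurrence of a pattern $\tau\in S_k$ in $\alpha\in S_n$ is a choice of indices $1\leq i_1<\dots<i_k\leq n$ such that $(\alpha_{i_1},\dots,\alpha_{i_k})$ is order-isomorphic to $(\tau_1,\dots,\tau_k)$ (i.e. $\alpha_{i_a}<\alpha_{i_b}$ if and only if $\tau_a<\tau_b$). The permutation $\alpha$ avoids $\tau$ if it has no occurrence of $\tau$, and contains $\tau$ exactly once if it has exactly one occurrence of $\tau$. For $\tau\in T_k^m$, $S_n(T_k^m;\tau)$ denotes the set of all permutations in $S_n$ that avoid every pattern in $T_k^m\setminus\{\tau\}$ and contain $\tau$ exactly once. The convention $0^0=1$ is used. *)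

theory Defs
  imports "HOL-Combinatorics.Multiset_Permutations"
begin

text \<open>
  A permutation of \<open>{1..n}\<close> in one-line notation is a list in \<^term>\<open>permutations_of_set {1..n}\<close>.
  Its entries start at 1, but its positions are list indices and hence start at 0.
\<close>

definition perms :: "nat \<Rightarrow> nat list set" where
  "perms n = permutations_of_set {1..n}"

definition perms_first :: "nat \<Rightarrow> nat \<Rightarrow> nat list set" where
  "perms_first k m = {\<sigma> \<in> perms k. \<sigma> \<noteq> [] \<and> \<sigma> ! 0 = m}"

text \<open>An occurrence is the strictly increasing list of the chosen positions.\<close>

definition occurrences :: "nat list \<Rightarrow> nat list \<Rightarrow> nat list set" where
  "occurrences \<tau> \<alpha> =
     {is. length is = length \<tau> \<and> sorted_wrt (<) is \<and> set is \<subseteq> {..<length \<alpha>} \<and>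
          (\<forall>a<length \<tau>. \<forall>b<length \<tau>. \<alpha> ! (is ! a) < \<alpha> ! (is ! b) \<longleftrightarrow> \<tau> ! a < \<tau> ! b)}"

definition avoids :: "nat list \<Rightarrow> nat list \<Rightarrow> bool" where
  "avoids \<alpha> \<tau> \<longleftrightarrow> occurrences \<tau> \<alpha> = {}"

definition contains_exactly_once :: "nat list \<Rightarrow> nat list \<Rightarrow> bool" where
  "contains_exactly_once \<alpha> \<tau> \<longleftrightarrow> (\<exists>!is. is \<in> occurrences \<tau> \<alpha>)"

definition perms_avoiding_once :: "nat \<Rightarrow> nat list set \<Rightarrow> nat list \<Rightarrow> nat list set" where
  "perms_avoiding_once n T \<tau> =
     {\<alpha> \<in> perms n. (\<forall>\<sigma> \<in> T - {\<tau>}. avoids \<alpha> \<sigma>) \<and> contains_exactly_once \<alpha> \<tau>}"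

end

theory Submission
  imports Defs "HOL-Library.Sublist"
begin

text \<open>
  Put \<open>r = k - 1\<close>. A subsequence of length \<open>k\<close> whose first entry is its least one is an occurrence
  of exactly one pattern in \<open>T_k^1\<close> (\<open>min_led_iff\<close>, \<open>order_iso_perms_unique\<close>). So \<open>\<alpha>\<close> is counted
  exactly when it has just one such subsequence and this one is order-isomorphic to \<open>\<tau>\<close>
  (\<open>avoiding_once_iff_led_once\<close>). An entry with \<open>c\<close> larger entries to its right is the head of
  \<open>c choose r\<close> such subsequences. For \<open>r > 0\<close> the condition therefore says that one entry has
  exactly \<open>r\<close> larger entries to its right, that these form the tail of \<open>\<tau>\<close> up to order isomorphism,
  and that every other entry has fewer than \<open>r\<close>.

  Since only the relative order matters, permutations of an arbitrary finite set can be counted, and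
  no relabelling is needed when an entry is removed. Let \<open>f n\<close> be the number for a set of size \<open>n\<close>,
  and split by the first entry \<open>a\<close> (\<open>led_once_Cons\<close>). If \<open>a\<close> is one of the \<open>r\<close> greatest elements, it
  leads no such subsequence and the rest is again counted by \<open>f\<close>. If exactly \<open>r\<close> elements exceed
  \<open>a\<close>, the rest must have no such subsequence at all and must contain its \<open>r\<close> greatest elements in
  the one order prescribed by \<open>\<tau>\<close>. If more than \<open>r\<close> elements exceed \<open>a\<close>, there are too many
  subsequences.

  The second case is counted by removing the least element instead (\<open>card_few_larger_fixed_top\<close>):
  it can be inserted precisely at the places with fewer than \<open>r\<close> entries to the right, which gives
  \<open>r\<close> places, and it changes neither the number of larger entries right of any other entry nor the
  order of the greatest \<open>r\<close> elements. Hence the second case contributes \<open>r ^ (n - 1 - r)\<close>, and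
  \<open>f n = r * f (n - 1) + r ^ (n - 1 - r)\<close> for \<open>n > r\<close>, with solution
  \<open>f n = (n - r) * r ^ (n - 1 - r)\<close> (\<open>card_led_once\<close>). The case \<open>r = 0\<close> is separate, because then
  every entry alone is an occurrence.
\<close>

section \<open>Order-isomorphic lists\<close>

definition order_iso :: "nat list \<Rightarrow> nat list \<Rightarrow> bool" where
  "order_iso ws ts \<longleftrightarrow> length ws = length ts \<and>
     (\<forall>a<length ts. \<forall>b<length ts. ws ! a < ws ! b \<longleftrightarrow> ts ! a < ts ! b)"

definition rank :: "nat set \<Rightarrow> nat \<Rightarrow> nat" where
  "rank A x = card {y \<in> A. y < x}"

lemma rank_less_rank_iff:
  assumes "finite A" "x \<in> A" "y \<in> A"
  shows "rank A x < rank A y \<longleftrightarrow> x < y"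
proof -
  have *: "rank A u < rank A v" if "u \<in> A" "u < v" for u v
    unfolding rank_def by (rule psubset_card_mono) (use assms(1) that in auto)
  show ?thesis using *[of x y] *[of y x] assms by (cases x y rule: linorder_cases) auto
qed

lemma rank_less_card: "finite A \<Longrightarrow> x \<in> A \<Longrightarrow> rank A x < card A"
  unfolding rank_def by (rule psubset_card_mono) auto

text \<open>
  The number of entries below a given one is determined by the comparisons between positions, so an
  order isomorphism preserves ranks.
\<close>

lemma rank_order_iso:
  assumes "order_iso p t" "distinct p" "distinct t" "a < length t"
  shows "rank (set p) (p ! a) = rank (set t) (t ! a)"
proof -
  have *: "rank (set l) (l ! a) = card {b. b < length l \<and> l ! b < l ! a}" if "distinct l" for l
  proof -
    have "{y \<in> set l. y < l ! a} = (!) l ` {b. b < length l \<and> l ! b < l ! a}"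
      by (auto simp: in_set_conv_nth)
    moreover have "inj_on ((!) l) {b. b < length l \<and> l ! b < l ! a}"
      using that by (auto simp: inj_on_def nth_eq_iff_index_eq)
    ultimately show ?thesis by (simp add: rank_def card_image)
  qed
  have "{b. b < length p \<and> p ! b < p ! a} = {b. b < length t \<and> t ! b < t ! a}"
    using assms by (auto simp: order_iso_def)
  then show ?thesis using * assms by simp
qed

text \<open>
  The isomorphic copy of \<open>t\<close> on \<open>B\<close> sends the entry of rank \<open>i\<close> to the element of \<open>B\<close> of rank \<open>i\<close>.
  With \<open>B = {1..k}\<close> this is the standardization of a list; with \<open>B\<close> the set of elements above some
  entry it is the order in which a pattern forces them to appear.
\<close>

lemma ex1_order_iso:
  assumes "distinct t" "finite B" "card B = length t"
  shows "\<exists>!p. p \<in> permutations_of_set B \<and> order_iso p t"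
proof (rule ex_ex1I)
  let ?b = "sorted_list_of_set B"
  define f where "f x = ?b ! rank (set t) x" for x
  have rk: "rank (set t) x < length ?b" if "x \<in> set t" for x
    using rank_less_card[of "set t" x] that assms by (simp add: distinct_card)
  have mono: "f x < f y \<longleftrightarrow> x < y" if "x \<in> set t" "y \<in> set t" for x y
  proof -
    have "?b ! i < ?b ! j \<longleftrightarrow> i < j" if "i < length ?b" "j < length ?b" for i j
      using that sorted_wrt_nth_less[OF strict_sorted_list_of_set[of B], of i j]
        sorted_wrt_nth_less[OF strict_sorted_list_of_set[of B], of j i]
      by (cases i j rule: linorder_cases) auto
    then show ?thesis unfolding f_def using rk that rank_less_rank_iff[of "set t"] by auto
  qed
  have inj: "inj_on f (set t)"
    using mono by (metis inj_onI less_irrefl linorder_neqE_nat)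
  have "f ` set t \<subseteq> B"
    using rk assms(2) nth_mem[of _ ?b] by (auto simp: f_def)
  moreover have "card (f ` set t) = card B"
    using inj assms by (simp add: card_image distinct_card)
  ultimately have "f ` set t = B" using assms(2) card_subset_eq by blast
  then have "map f t \<in> permutations_of_set B"
    using inj assms by (auto simp: permutations_of_set_def distinct_map)
  moreover have "order_iso (map f t) t" using mono by (auto simp: order_iso_def)
  ultimately show "\<exists>p. p \<in> permutations_of_set B \<and> order_iso p t" by blast
next
  fix p q
  assume p: "p \<in> permutations_of_set B \<and> order_iso p t"
    and q: "q \<in> permutations_of_set B \<and> order_iso q t"
  have l: "length p = length t" "length q = length t" using p q by (auto simp: order_iso_def)
  have sets: "set p = B" "distinct p" "set q = B" "distinct q"
    using p q permutations_of_setD by blast+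
  show "p = q"
  proof (rule nth_equalityI)
    show "length p = length q" using l by simp
    fix a assume "a < length p"
    then have a: "a < length t" using l by simp
    have "rank B (p ! a) = rank B (q ! a)"
      using rank_order_iso[of p t a] rank_order_iso[of q t a] p q a assms(1) sets by simp
    moreover have "p ! a \<in> B" "q ! a \<in> B"
      using nth_mem[of a p] nth_mem[of a q] a l sets by auto
    ultimately show "p ! a = q ! a"
      using rank_less_rank_iff[OF assms(2), of "p ! a" "q ! a"]
        rank_less_rank_iff[OF assms(2), of "q ! a" "p ! a"] by simp
  qed
qed

lemma order_iso_Cons:
  assumes "\<And>x. x \<in> set ws \<Longrightarrow> w < x" "\<And>x. x \<in> set ts \<Longrightarrow> t < x"
  shows "order_iso (w # ws) (t # ts) \<longleftrightarrow> order_iso ws ts"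
proof -
  have "\<not> ws ! a < w" "w < ws ! a" if "a < length ws" for a
    using assms(1)[of "ws ! a"] that by auto
  moreover have "\<not> ts ! a < t" "t < ts ! a" if "a < length ts" for a
    using assms(2)[of "ts ! a"] that by auto
  ultimately show ?thesis by (auto simp: order_iso_def All_less_Suc2)
qed

section \<open>Subsequences with least head\<close>

lemma subseq_iff_map_nth:
  "subseq w xs \<longleftrightarrow> (\<exists>is. sorted_wrt (<) is \<and> set is \<subseteq> {..<length xs} \<and> w = map ((!) xs) is)"
proof
  assume "subseq w xs"
  then show "\<exists>is. sorted_wrt (<) is \<and> set is \<subseteq> {..<length xs} \<and> w = map ((!) xs) is"
  proof (induction rule: list_emb.induct)
    case (list_emb_Nil ys)
    show ?case by (rule exI[of _ "[]"]) auto
  next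
    case (list_emb_Cons xs ys y)
    then obtain js where "sorted_wrt (<) js" "set js \<subseteq> {..<length ys}" "xs = map ((!) ys) js" by auto
    then show ?case by (intro exI[of _ "map Suc js"]) (auto simp: sorted_wrt_map)
  next
    case (list_emb_Cons2 x y xs ys)
    then obtain js where "sorted_wrt (<) js" "set js \<subseteq> {..<length ys}" "xs = map ((!) ys) js" by auto
    then show ?case using list_emb_Cons2
      by (intro exI[of _ "0 # map Suc js"]) (auto simp: sorted_wrt_map)
  qed
next
  assume "\<exists>is. sorted_wrt (<) is \<and> set is \<subseteq> {..<length xs} \<and> w = map ((!) xs) is"
  then obtain js where js: "sorted_wrt (<) js" "set js \<subseteq> {..<length xs}" "w = map ((!) xs) js" by auto
  have "js = sorted_list_of_set (set js)"
    using js(1) by (metis finite_set sorted_list_of_set.idem_if_sorted_distinct strict_sorted_iff)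
  moreover have "subseq js [0..<length xs]"
    using js by (intro sorted_subset_imp_subseq) (auto simp: sorted_wrt_upt)
  ultimately show "subseq w xs"
    using js subseq_map[of js "[0..<length xs]" "(!) xs"] by (simp add: map_nth)
qed

text \<open>
  The subsequences that realize some pattern of length \<open>Suc r\<close> starting with its least entry.
\<close>

definition min_led :: "nat \<Rightarrow> nat list \<Rightarrow> nat list set" where
  "min_led r xs = {w. subseq w xs \<and> length w = Suc r \<and> (\<forall>y\<in>set (tl w). hd w < y)}"

text \<open>
  The entrywise form of the absence of such subsequences, as \<open>min_led_empty_iff\<close> shows.
\<close>

primrec few_larger :: "nat \<Rightarrow> nat list \<Rightarrow> bool" where
  "few_larger r [] \<longleftrightarrow> True"
| "few_larger r (a # xs) \<longleftrightarrow> length (filter ((<) a) xs) < r \<and> few_larger r xs"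

text \<open>
  Here \<open>\<tau>\<close> is meant to begin with its least entry; as \<open>min_led r\<close> consists of lists of length
  \<open>Suc r\<close>, the parameter is the length of the rest of \<open>\<tau>\<close>.
\<close>

definition led_once :: "nat list \<Rightarrow> nat list \<Rightarrow> bool" where
  "led_once \<tau> xs \<longleftrightarrow> (\<exists>w. min_led (length \<tau> - 1) xs = {w} \<and> order_iso w \<tau>)"

lemma min_led_Nil [simp]: "min_led r [] = {}"
  by (auto simp: min_led_def)

lemma subseq_set_subset: "subseq v xs \<Longrightarrow> set v \<subseteq> set xs"
  by (auto simp: subseq_conv_nths dest: in_set_nthsD)

lemma subseq_filter_iff:
  "subseq v (filter P xs) \<longleftrightarrow> subseq v xs \<and> (\<forall>y\<in>set v. P y)"
proof (intro iffI conjI)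
  assume v: "subseq v (filter P xs)"
  show "subseq v xs" using v subseq_filter_left subseq_order.trans by blast
  show "\<forall>y\<in>set v. P y" using subseq_set_subset[OF v] by auto
next
  assume v: "subseq v xs \<and> (\<forall>y\<in>set v. P y)"
  then have "subseq (filter P v) (filter P xs)" by (intro subseq_filter) simp
  moreover have "filter P v = v" using v by (simp add: filter_id_conv)
  ultimately show "subseq v (filter P xs)" by simp
qed

text \<open>
  The subsequences led by the first entry \<open>a\<close> correspond to the choices of \<open>r\<close> among the larger
  entries after it.
\<close>

lemma min_led_Cons:
  "min_led r (a # xs) = (#) a ` {v. subseq v (filter ((<) a) xs) \<and> length v = r} \<union> min_led r xs"
proof (rule set_eqI)
  fix w
  show "w \<in> min_led r (a # xs) \<longleftrightarrow>
    w \<in> (#) a ` {v. subseq v (filter ((<) a) xs) \<and> length v = r} \<union> min_led r xs"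
  proof (cases w)
    case Nil
    then show ?thesis by (auto simp: min_led_def)
  next
    case (Cons b v)
    then show ?thesis
      by (auto simp: min_led_def subseq_filter_iff dest: subseq_Cons')
  qed
qed

lemma subseqs_of_length_empty_iff: "{v. subseq v xs \<and> length v = r} = {} \<longleftrightarrow> length xs < r"
proof
  assume "{v. subseq v xs \<and> length v = r} = {}"
  moreover have "subseq (take r xs) xs" by (simp add: prefix_imp_subseq take_is_prefix)
  ultimately show "length xs < r" by (metis (mono_tags, lifting) empty_Collect_eq length_take min.absorb2 not_less)
next
  assume "length xs < r"
  then show "{v. subseq v xs \<and> length v = r} = {}" by (auto dest: list_emb_length)
qed

lemma min_led_empty_iff: "min_led r xs = {} \<longleftrightarrow> few_larger r xs"
  by (induction xs)
    (simp, simp only: min_led_Cons Un_empty image_is_empty subseqs_of_length_empty_iff few_larger.simps)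

text \<open>
  The first \<open>r\<close> and the last \<open>r\<close> entries will do; for \<open>r > 0\<close> they already differ in their heads.
\<close>

lemma two_subseqs_of_length:
  assumes "distinct xs" "0 < r" "r < length xs"
  shows "\<exists>u v. subseq u xs \<and> subseq v xs \<and> length u = r \<and> length v = r \<and> u \<noteq> v"
proof -
  let ?u = "take r xs" and ?v = "drop (length xs - r) xs"
  have "xs \<noteq> []" using assms(3) by auto
  then have "?u ! 0 \<noteq> ?v ! 0" using assms nth_eq_iff_index_eq[of xs 0 "length xs - r"] by simp
  then have "?u \<noteq> ?v" by metis
  moreover have "subseq ?u xs" "subseq ?v xs"
    by (auto simp: prefix_imp_subseq take_is_prefix suffix_imp_subseq suffix_drop)
  ultimately show ?thesis using assms
    by (intro exI[of _ ?u] exI[of _ ?v]) auto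
qed

text \<open>
  The number of subsequences led by \<open>a\<close> is zero, one or at least two according to whether \<open>L\<close> is
  shorter than, as long as or longer than \<open>ts\<close>. This trichotomy fails for an empty \<open>ts\<close>, when the
  empty list is always the one choice from \<open>L\<close>.
\<close>

lemma led_once_Cons:
  assumes "distinct (a # xs)" "0 < length ts" "\<And>x. x \<in> set ts \<Longrightarrow> t < x"
  defines "r \<equiv> length ts" and "L \<equiv> filter ((<) a) xs"
  shows "led_once (t # ts) (a # xs) \<longleftrightarrow>
    length L < r \<and> led_once (t # ts) xs \<or> length L = r \<and> few_larger r xs \<and> order_iso L ts"
proof -
  define V where "V = {v. subseq v L \<and> length v = r}"
  have eq: "min_led r (a # xs) = (#) a ` V \<union> min_led r xs"
    by (simp add: min_led_Cons V_def L_def)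
  have once: "led_once (t # ts) ys \<longleftrightarrow> (\<exists>w. min_led r ys = {w} \<and> order_iso w (t # ts))" for ys
    by (simp add: led_once_def r_def)
  have notin: "a # v \<notin> min_led r xs" for v
    using assms(1) by (auto simp: min_led_def dest: subseq_set_subset)
  consider "length L < r" | "length L = r" | "r < length L" by linarith
  then show ?thesis
  proof cases
    case 1
    then have "V = {}" using subseqs_of_length_empty_iff unfolding V_def by blast
    then show ?thesis using 1 by (simp add: once eq)
  next
    case 2
    then have "V = {L}" unfolding V_def by (auto simp: subseq_same_length)
    then have "(\<exists>w. min_led r (a # xs) = {w} \<and> order_iso w (t # ts)) \<longleftrightarrow>
        min_led r xs = {} \<and> order_iso (a # L) (t # ts)"
      using notin[of L] unfolding eq by auto
    also have "order_iso (a # L) (t # ts) \<longleftrightarrow> order_iso L ts"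
      using assms(3) by (intro order_iso_Cons) (auto simp: L_def)
    finally show ?thesis using 2 by (simp add: once min_led_empty_iff)
  next
    case 3
    then obtain u v where "u \<in> V" "v \<in> V" "u \<noteq> v"
      using two_subseqs_of_length[of L r] assms unfolding V_def by auto
    then have "min_led r (a # xs) \<noteq> {w}" for w unfolding eq by (cases "a # u = w") auto
    then show ?thesis using 3 by (auto simp: once)
  qed
qed

section \<open>Counting lists without a least-headed subsequence\<close>

text \<open>
  A new least entry is never among the larger entries right of another one, and all the entries right
  of it are larger than itself.
\<close>

lemma few_larger_insert:
  assumes "\<And>x. x \<in> set xs \<union> set ys \<Longrightarrow> m < x"
  shows "few_larger r (xs @ m # ys) \<longleftrightarrow> few_larger r (xs @ ys) \<and> length ys < r"
  using assms
proof (induction xs)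
  case Nil
  then have "filter ((<) m) ys = ys" by (auto intro: filter_True)
  then show ?case by auto
next
  case (Cons x xs)
  then have "\<not> x < m" by (auto dest: less_asym)
  then show ?case using Cons by auto
qed

lemma few_larger_length_le: "length xs \<le> r \<Longrightarrow> few_larger r xs"
proof (induction xs)
  case (Cons a xs)
  then show ?case using length_filter_le[of "(<) a" xs] by (simp; linarith)
qed simp

text \<open>
  Induction on the number of elements outside \<open>B\<close>, removing the least element \<open>m\<close> of \<open>C\<close>. A list
  \<open>xs @ m # ys\<close> belongs to the set for \<open>C\<close> iff \<open>xs @ ys\<close> belongs to that for \<open>C - {m}\<close> and \<open>ys\<close> has
  fewer than \<open>card B\<close> entries, so each list without \<open>m\<close> extends in \<open>card B\<close> ways. In the base case
  \<open>p\<close> itself is the only list, and it is too short to violate the condition.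
\<close>

lemma card_few_larger_fixed_top:
  assumes "finite C" "B \<subseteq> C" "0 < card B" "p \<in> permutations_of_set B"
    and top: "\<And>x y. x \<in> C - B \<Longrightarrow> y \<in> B \<Longrightarrow> x < y"
  shows "card {xs \<in> permutations_of_set C. few_larger (card B) xs \<and> filter (\<lambda>x. x \<in> B) xs = p}
    = card B ^ card (C - B)"
  using assms(1,2) top
proof (induction "card (C - B)" arbitrary: C)
  case 0
  then have "C = B" using finite_subset[of B C] by auto
  then have "{xs \<in> permutations_of_set C. few_larger (card B) xs \<and> filter (\<lambda>x. x \<in> B) xs = p} = {p}"
    using assms(4) few_larger_length_le[of p "card B"] distinct_card[of p]
    by (auto simp: permutations_of_set_def filter_id_conv)
  then show ?case using \<open>C = B\<close> by simp
next
  case (Suc d C)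
  let ?r = "card B"
  let ?G = "\<lambda>C. {xs \<in> permutations_of_set C. few_larger ?r xs \<and> filter (\<lambda>x. x \<in> B) xs = p}"
  define m where "m = Min C"
  define C' where "C' = C - {m}"
  have "C - B \<noteq> {}" using Suc.hyps(2) by (metis card.empty nat.distinct(1))
  then obtain x where x: "x \<in> C" "x \<notin> B" by auto
  have mC: "m \<in> C" using x Suc.prems(1) unfolding m_def by (intro Min_in) auto
  have "m \<le> x" using x Suc.prems(1) unfolding m_def by simp
  then have mB: "m \<notin> B" using Suc.prems(3)[of x m] x by auto
  have less: "m < y" if "y \<in> C'" for y
    using that Min_le[OF Suc.prems(1), of y] unfolding m_def C'_def by auto
  have C: "C = insert m C'" "m \<notin> C'" "finite C'" "B \<subseteq> C'"
    using mC mB Suc.prems by (auto simp: C'_def)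
  have "C - B = insert m (C' - B)" using C mB by auto
  then have d: "card (C' - B) = d" using Suc.hyps(2) C by simp
  have IH: "card (?G C') = ?r ^ d"
    using Suc.hyps(1)[of C'] d C Suc.prems by auto
  have rC: "?r \<le> card C'" using C by (simp add: card_mono)
  \<comment> \<open>\<open>ins (i, xs)\<close> inserts \<open>m\<close> so that exactly \<open>i\<close> entries follow it; all \<open>i < card B\<close> are possible
    because \<open>xs\<close> has at least \<open>card B\<close> entries.\<close>
  define ins where "ins = (\<lambda>(i, xs :: nat list). take (card C' - i) xs @ m # drop (card C' - i) xs)"
  have len: "length xs = card C'" if "xs \<in> permutations_of_set C'" for xs
    using that by (auto simp: permutations_of_set_def distinct_card)
  have perm: "xs @ m # ys \<in> permutations_of_set C \<longleftrightarrow> xs @ ys \<in> permutations_of_set C'" for xs ys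
    using C by (auto simp: permutations_of_set_def)
  have G: "xs @ m # ys \<in> ?G C \<longleftrightarrow> xs @ ys \<in> ?G C' \<and> length ys < ?r" for xs ys
  proof (cases "xs @ ys \<in> permutations_of_set C'")
    case True
    then have "few_larger ?r (xs @ m # ys) \<longleftrightarrow> few_larger ?r (xs @ ys) \<and> length ys < ?r"
      using less by (intro few_larger_insert) (auto simp: permutations_of_set_def)
    then show ?thesis using True perm mB by auto
  qed (use perm in simp)
  have "bij_betw ins ({..<?r} \<times> ?G C') (?G C)"
  proof (rule bij_betw_imageI)
    show "inj_on ins ({..<?r} \<times> ?G C')"
    proof (rule inj_onI)
      fix u v
      assume uv: "u \<in> {..<?r} \<times> ?G C'" "v \<in> {..<?r} \<times> ?G C'" "ins u = ins v"
      obtain i xs j ys where u: "u = (i, xs)" and v: "v = (j, ys)" by (cases u, cases v)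
      have i: "i < ?r" "j < ?r"
        and p: "xs \<in> permutations_of_set C'" "ys \<in> permutations_of_set C'"
        and eq: "ins (i, xs) = ins (j, ys)"
        using uv unfolding u v by auto
      have "m \<notin> set xs" using p C by (auto simp: permutations_of_set_def)
      then have split: "take (card C' - i) xs = take (card C' - j) ys"
        "drop (card C' - i) xs = drop (card C' - j) ys"
        using eq unfolding ins_def prod.case
        by (subst (asm) append_Cons_eq_iff; auto dest: in_set_takeD in_set_dropD)+
      have "length (drop (card C' - i) xs) = length (drop (card C' - j) ys)"
        using split(2) by (rule arg_cong)
      then have "i = j" using i rC len[OF p(1)] len[OF p(2)] by simp
      moreover have "xs = ys"
        using split append_take_drop_id[of "card C' - i" xs] append_take_drop_id[of "card C' - j" ys]
        by simp
      ultimately show "u = v" by (simp add: u v)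
    qed
    show "ins ` ({..<?r} \<times> ?G C') = ?G C"
    proof (intro equalityI subsetI)
      fix z assume "z \<in> ins ` ({..<?r} \<times> ?G C')"
      then obtain i xs where z: "i < ?r" "xs \<in> ?G C'" "z = ins (i, xs)" by auto
      then have "length (drop (card C' - i) xs) < ?r" using len[of xs] rC by simp
      then show "z \<in> ?G C"
        unfolding z(3) ins_def prod.case G using z by simp
    next
      fix z assume z: "z \<in> ?G C"
      then have "m \<in> set z" using mC by (auto simp: permutations_of_set_def)
      then obtain xs ys where zs: "z = xs @ m # ys" by (auto dest: split_list)
      then have xy: "xs @ ys \<in> ?G C'" "length ys < ?r" using z G by auto
      then have "card C' = length xs + length ys" using len[of "xs @ ys"] by simp
      then have "z = ins (length ys, xs @ ys)" by (simp add: ins_def zs)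
      then show "z \<in> ins ` ({..<?r} \<times> ?G C')" using xy by blast
    qed
  qed
  then have "card (?G C) = ?r * card (?G C')"
    by (auto dest!: bij_betw_same_card simp: card_cartesian_product)
  then show ?case using IH by (simp flip: Suc.hyps(2))
qed

section \<open>The recursion on the first entry\<close>

lemma bij_betw_number_larger:
  fixes A :: "nat set"
  assumes "finite A"
  shows "bij_betw (\<lambda>a. card {y \<in> A. a < y}) A {..<card A}"
proof -
  have *: "card {y \<in> A. v < y} < card {y \<in> A. u < y}" if "v \<in> A" "u < v" for u v
    by (rule psubset_card_mono) (use assms that in auto)
  have inj: "inj_on (\<lambda>a. card {y \<in> A. a < y}) A"
  proof (rule inj_onI)
    fix u v assume "u \<in> A" "v \<in> A" "card {y \<in> A. u < y} = card {y \<in> A. v < y}"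
    then show "u = v" using *[of u v] *[of v u] by (cases u v rule: linorder_cases) auto
  qed
  moreover have "card {y \<in> A. a < y} < card A" if "a \<in> A" for a
    by (rule psubset_card_mono) (use assms that in auto)
  then have "(\<lambda>a. card {y \<in> A. a < y}) ` A \<subseteq> {..<card A}" by auto
  then have "(\<lambda>a. card {y \<in> A. a < y}) ` A = {..<card A}"
    using card_image[OF inj] by (intro card_subset_eq) auto
  ultimately show ?thesis by (simp add: bij_betw_def)
qed

lemma card_permutations_of_set_first:
  assumes "finite A" "A \<noteq> {}"
  shows "card {xs \<in> permutations_of_set A. P xs} =
    (\<Sum>a\<in>A. card {xs \<in> permutations_of_set (A - {a}). P (a # xs)})"
proof -
  have "{xs \<in> permutations_of_set A. P xs} =
      (\<Union>a\<in>A. (#) a ` {xs \<in> permutations_of_set (A - {a}). P (a # xs)})"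
    using assms(2) by (auto simp: permutations_of_set_nonempty)
  then show ?thesis using assms(1)
    by simp (subst card_UN_disjoint; auto simp: card_image)
qed

text \<open>
  The contribution \<open>val i\<close> of a first entry depends only on the number \<open>i\<close> of elements above it, and
  \<open>i\<close> takes each value below \<open>card A\<close> once. For \<open>card A \<le> r\<close> both sides vanish, the right-hand side
  by truncated subtraction.
\<close>

lemma card_led_once:
  assumes "finite A" "0 < length ts" "distinct ts" "\<And>x. x \<in> set ts \<Longrightarrow> t < x"
  defines "r \<equiv> length ts"
  shows "card {xs \<in> permutations_of_set A. led_once (t # ts) xs} = (card A - r) * r ^ (card A - r - 1)"
  using assms(1)
proof (induction "card A" arbitrary: A)
  case 0
  then show ?case by (simp add: led_once_def)
next
  case (Suc n A)
  let ?c = "\<lambda>a. card {y \<in> A. a < y}"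
  let ?f = "\<lambda>A. {xs \<in> permutations_of_set A. led_once (t # ts) xs}"
  define val where "val i = (if i < r then (n - r) * r ^ (n - r - 1) else if i = r then r ^ (n - r) else 0)" for i
  have "A \<noteq> {}" using Suc.hyps by auto
  have summand: "card {xs \<in> permutations_of_set (A - {a}). led_once (t # ts) (a # xs)} = val (?c a)"
    if a: "a \<in> A" for a
  proof -
    define A' where "A' = A - {a}"
    define B where "B = {y \<in> A. a < y}"
    have A': "card A' = n" "finite A'" using a Suc.hyps Suc.prems by (auto simp: A'_def)
    have B: "B \<subseteq> A'" by (auto simp: A'_def B_def)
    have L: "filter ((<) a) xs = filter (\<lambda>x. x \<in> B) xs"
      "set (filter (\<lambda>x. x \<in> B) xs) = B" "length (filter (\<lambda>x. x \<in> B) xs) = card B"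
      if "xs \<in> permutations_of_set A'" for xs
    proof -
      show "filter ((<) a) xs = filter (\<lambda>x. x \<in> B) xs"
        using that by (intro filter_cong) (auto simp: permutations_of_set_def A'_def B_def)
      show *: "set (filter (\<lambda>x. x \<in> B) xs) = B"
        using that B by (auto simp: permutations_of_set_def)
      show "length (filter (\<lambda>x. x \<in> B) xs) = card B"
        using distinct_card[of "filter (\<lambda>x. x \<in> B) xs"] that * by (simp add: permutations_of_set_def)
    qed
    have once: "led_once (t # ts) (a # xs) \<longleftrightarrow> card B < r \<and> led_once (t # ts) xs \<or>
        card B = r \<and> few_larger r xs \<and> order_iso (filter (\<lambda>x. x \<in> B) xs) ts"
      if "xs \<in> permutations_of_set A'" for xs
      using led_once_Cons[of a xs ts t] that assms L[OF that]
      by (auto simp: permutations_of_set_def A'_def r_def)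
    consider "card B < r" | "card B = r" | "r < card B" by linarith
    then show ?thesis
    proof cases
      case 1
      then have "{xs \<in> permutations_of_set A'. led_once (t # ts) (a # xs)} = ?f A'"
        using once by auto
      then show ?thesis using 1 Suc.hyps(1)[of A'] A' by (simp add: val_def A'_def B_def)
    next
      case 2
      have fB: "finite B" using Suc.prems by (simp add: B_def)
      \<comment> \<open>Only one arrangement \<open>p\<close> of the elements above \<open>a\<close> is isomorphic to \<open>ts\<close>.\<close>
      obtain p where p: "p \<in> permutations_of_set B" "order_iso p ts"
        and uniq: "\<And>q. q \<in> permutations_of_set B \<Longrightarrow> order_iso q ts \<Longrightarrow> q = p"
        using ex1_order_iso[of ts B] assms(3) fB 2 unfolding r_def by blast
      have "filter (\<lambda>x. x \<in> B) xs \<in> permutations_of_set B" if "xs \<in> permutations_of_set A'" for xs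
        using L[OF that] that by (auto simp: permutations_of_set_def)
      then have "{xs \<in> permutations_of_set A'. led_once (t # ts) (a # xs)} =
          {xs \<in> permutations_of_set A'. few_larger (card B) xs \<and> filter (\<lambda>x. x \<in> B) xs = p}"
        using once uniq p(2) 2 by auto
      also have "card \<dots> = card B ^ card (A' - B)"
        using A' B p 2 assms by (intro card_few_larger_fixed_top) (auto simp: A'_def B_def)
      also have "card (A' - B) = n - r" using A' B 2 fB by (simp add: card_Diff_subset)
      finally show ?thesis using 2 by (simp add: val_def A'_def B_def)
    next
      case 3
      then have "{xs \<in> permutations_of_set A'. led_once (t # ts) (a # xs)} = {}"
        using once by auto
      then show ?thesis using 3 by (simp add: val_def A'_def B_def)
    qed
  qed
  have "card (?f A) = (\<Sum>a\<in>A. val (?c a))"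
    using card_permutations_of_set_first[OF Suc.prems \<open>A \<noteq> {}\<close>] summand by simp
  also have "\<dots> = (\<Sum>i<Suc n. val i)"
    using sum.reindex_bij_betw[OF bij_betw_number_larger[OF Suc.prems], of val] Suc.hyps(2) by simp
  also have "\<dots> = (Suc n - r) * r ^ (Suc n - r - 1)"
  proof (cases "r \<le> n")
    case False
    then have "val i = 0" if "i < Suc n" for i using that by (simp add: val_def)
    then show ?thesis using False by simp
  next
    case True
    then have "(\<Sum>i<Suc n. val i) = (\<Sum>i<Suc r. val i)"
      by (intro sum.mono_neutral_right) (auto simp: val_def)
    also have "\<dots> = r * ((n - r) * r ^ (n - r - 1)) + r ^ (n - r)"
      by (simp add: val_def)
    also have "\<dots> = (Suc n - r) * r ^ (Suc n - r - 1)"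
    proof (cases "n = r")
      case False
      then obtain e where "n - r = Suc e" using True by (metis Suc_diff_Suc le_neq_implies_less)
      then show ?thesis using True by (simp add: Suc_diff_le algebra_simps)
    qed simp
    finally show ?thesis .
  qed
  finally show ?case using Suc.hyps(2) by simp
qed

section \<open>Occurrences as subsequences\<close>

text \<open>
  In a list without repetitions a subsequence determines the positions of its entries.
\<close>

lemma bij_betw_occurrences:
  assumes "distinct \<alpha>"
  shows "bij_betw (map ((!) \<alpha>)) (occurrences \<sigma> \<alpha>) {w. subseq w \<alpha> \<and> order_iso w \<sigma>}"
proof (rule bij_betw_imageI)
  show "inj_on (map ((!) \<alpha>)) (occurrences \<sigma> \<alpha>)"
  proof (rule inj_onI)
    fix x y assume *: "x \<in> occurrences \<sigma> \<alpha>" "y \<in> occurrences \<sigma> \<alpha>" "map ((!) \<alpha>) x = map ((!) \<alpha>) y"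
    have "inj_on ((!) \<alpha>) (set x \<union> set y)"
      using assms * by (intro inj_on_nth) (auto simp: occurrences_def)
    then show "x = y" using * map_inj_on by blast
  qed
  show "map ((!) \<alpha>) ` occurrences \<sigma> \<alpha> = {w. subseq w \<alpha> \<and> order_iso w \<sigma>}"
    by (auto simp: occurrences_def order_iso_def subseq_iff_map_nth image_iff)
qed

lemma avoids_iff:
  assumes "distinct \<alpha>"
  shows "avoids \<alpha> \<sigma> \<longleftrightarrow> (\<forall>w. subseq w \<alpha> \<longrightarrow> \<not> order_iso w \<sigma>)"
  using bij_betw_occurrences[OF assms, of \<sigma>] unfolding avoids_def bij_betw_def by auto

lemma contains_exactly_once_iff:
  assumes "distinct \<alpha>"
  shows "contains_exactly_once \<alpha> \<sigma> \<longleftrightarrow> (\<exists>w. {w. subseq w \<alpha> \<and> order_iso w \<sigma>} = {w})"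
proof -
  have "contains_exactly_once \<alpha> \<sigma> \<longleftrightarrow> card (occurrences \<sigma> \<alpha>) = 1"
    by (auto simp: contains_exactly_once_def card_1_singleton_iff Ex1_def)
  also have "\<dots> \<longleftrightarrow> card {w. subseq w \<alpha> \<and> order_iso w \<sigma>} = 1"
    using bij_betw_same_card[OF bij_betw_occurrences[OF assms]] by metis
  finally show ?thesis by (auto simp: card_1_singleton_iff)
qed

text \<open>
  The left-hand side has \<open>Suc 0\<close> for \<open>1\<close>, since it is to rewrite terms in simplified form.
\<close>

lemma perms_first_1_iff:
  "\<sigma> \<in> perms_first k (Suc 0) \<longleftrightarrow>
     \<sigma> \<in> permutations_of_set {1..k} \<and> (\<exists>ts. \<sigma> = 1 # ts \<and> (\<forall>y\<in>set ts. 1 < y))"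
proof
  assume \<sigma>: "\<sigma> \<in> perms_first k (Suc 0)"
  then obtain ts where ts: "\<sigma> = 1 # ts" by (cases \<sigma>) (auto simp: perms_first_def)
  have "1 < y" if "y \<in> set ts" for y
  proof -
    have "1 # ts \<in> permutations_of_set {1..k}"
      using \<sigma> by (simp add: ts perms_first_def perms_def)
    then have "y \<in> {1..k}" "y \<noteq> 1"
      using that permutations_of_setD[of "1 # ts" "{1..k}"] by auto
    then show ?thesis by simp
  qed
  then show "\<sigma> \<in> permutations_of_set {1..k} \<and> (\<exists>ts. \<sigma> = 1 # ts \<and> (\<forall>y\<in>set ts. 1 < y))"
    using \<sigma> ts by (auto simp: perms_first_def perms_def)
qed (auto simp: perms_first_def perms_def)

lemma order_iso_sym: "order_iso v w \<Longrightarrow> order_iso w v"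
  by (auto simp: order_iso_def)

lemma order_iso_trans: "order_iso u v \<Longrightarrow> order_iso v w \<Longrightarrow> order_iso u w"
  by (auto simp: order_iso_def)

lemma least_head_order_iso:
  assumes "order_iso w \<sigma>" "w \<noteq> []" "\<forall>y\<in>set (tl w). hd w < y"
  shows "\<forall>y\<in>set (tl \<sigma>). hd \<sigma> < y"
proof -
  obtain a v where w: "w = a # v" using assms(2) by (cases w) auto
  then obtain s ss where s: "\<sigma> = s # ss" using assms(1) by (cases \<sigma>) (auto simp: order_iso_def)
  have "s < ss ! i" if "i < length ss" for i
  proof -
    have "length v = length ss" using assms(1) w s by (simp add: order_iso_def)
    then have "w ! 0 < w ! Suc i" using assms(3) w that by auto
    then show ?thesis using assms(1) that unfolding order_iso_def s by fastforce
  qed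
  then show ?thesis unfolding s by (auto simp: in_set_conv_nth)
qed

text \<open>
  The pattern realized by a subsequence is its standardization, which begins with \<open>1\<close> exactly when
  the head of the subsequence is its least entry.
\<close>

lemma min_led_iff:
  assumes "distinct \<alpha>"
  shows "w \<in> min_led r \<alpha> \<longleftrightarrow> subseq w \<alpha> \<and> (\<exists>\<sigma> \<in> perms_first (Suc r) 1. order_iso w \<sigma>)"
proof
  assume w: "w \<in> min_led r \<alpha>"
  then have "distinct w" "length w = Suc r" using assms
    by (auto simp: min_led_def subseq_conv_nths)
  then obtain \<sigma> where \<sigma>: "\<sigma> \<in> permutations_of_set {1..Suc r}" "order_iso w \<sigma>"
    using ex1_order_iso[of w "{1..Suc r}"] order_iso_sym by fastforce
  have le: "\<forall>y\<in>set (tl \<sigma>). hd \<sigma> < y"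
    using w by (intro least_head_order_iso[OF \<sigma>(2)]) (auto simp: min_led_def)
  have set: "set \<sigma> = {1..Suc r}" using \<sigma> by (simp add: permutations_of_set_def)
  then obtain s ss where s: "\<sigma> = s # ss" by (cases \<sigma>) auto
  have "1 \<in> set \<sigma>" "s \<in> {1..Suc r}" using set s by auto
  then have "s = 1" using le s by auto
  then show "subseq w \<alpha> \<and> (\<exists>\<sigma> \<in> perms_first (Suc r) 1. order_iso w \<sigma>)"
    using w \<sigma> le s by (auto simp: min_led_def perms_first_1_iff)
next
  assume "subseq w \<alpha> \<and> (\<exists>\<sigma> \<in> perms_first (Suc r) 1. order_iso w \<sigma>)"
  then obtain \<sigma> where \<sigma>: "subseq w \<alpha>" "\<sigma> \<in> perms_first (Suc r) 1" "order_iso w \<sigma>" by auto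
  then have len: "length w = Suc r"
    by (auto simp: order_iso_def perms_first_def perms_def dest: length_finite_permutations_of_set)
  have "\<forall>y\<in>set (tl w). hd w < y"
    using \<sigma>(2) by (intro least_head_order_iso[OF order_iso_sym[OF \<sigma>(3)]]) (auto simp: perms_first_1_iff)
  then show "w \<in> min_led r \<alpha>" using \<sigma> len by (simp add: min_led_def)
qed

lemma order_iso_perms_unique:
  assumes "\<sigma> \<in> perms_first k 1" "\<tau> \<in> perms_first k 1" "order_iso w \<sigma>" "order_iso w \<tau>"
  shows "\<sigma> = \<tau>"
proof -
  have "\<sigma> \<in> permutations_of_set {1..k}" "\<tau> \<in> permutations_of_set {1..k}"
    using assms by (auto simp: perms_first_1_iff)
  moreover have "order_iso \<sigma> \<tau>" "order_iso \<tau> \<tau>"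
    using assms order_iso_sym order_iso_trans by blast+
  moreover have "distinct \<tau>" "card {1..k} = length \<tau>"
    using calculation(2) length_finite_permutations_of_set[of \<tau> "{1..k}"]
    by (auto simp: permutations_of_set_def)
  ultimately show ?thesis
    using ex1_order_iso[of \<tau> "{1..k}"] by blast
qed

text \<open>
  The least-headed subsequences of length \<open>k\<close> are partitioned by the patterns that they realize. So
  having one occurrence of \<open>\<tau>\<close> and none of the other patterns means having only one such subsequence,
  with pattern \<open>\<tau>\<close>.
\<close>

lemma avoiding_once_iff_led_once:
  assumes "distinct \<alpha>" and \<tau>: "\<tau> \<in> perms_first k 1"
  shows "(\<forall>\<sigma> \<in> perms_first k 1 - {\<tau>}. avoids \<alpha> \<sigma>) \<and> contains_exactly_once \<alpha> \<tau> \<longleftrightarrow>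
    led_once \<tau> \<alpha>"
proof -
  let ?O = "\<lambda>\<sigma>. {w. subseq w \<alpha> \<and> order_iso w \<sigma>}"
  let ?M = "min_led (length \<tau> - 1) \<alpha>"
  have "length \<tau> = k" using \<tau> by (auto simp: perms_first_def perms_def length_finite_permutations_of_set)
  then have k: "Suc (length \<tau> - 1) = k" using \<tau> by (cases \<tau>) (auto simp: perms_first_def)
  have M: "w \<in> ?M \<longleftrightarrow> (\<exists>\<sigma> \<in> perms_first k 1. w \<in> ?O \<sigma>)" for w
    using min_led_iff[OF assms(1), of w "length \<tau> - 1"] unfolding k by auto
  have "(\<forall>\<sigma> \<in> perms_first k 1 - {\<tau>}. ?O \<sigma> = {}) \<and> (\<exists>w. ?O \<tau> = {w}) \<longleftrightarrow>
      (\<exists>w. ?M = {w} \<and> order_iso w \<tau>)"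
  proof
    assume *: "(\<forall>\<sigma> \<in> perms_first k 1 - {\<tau>}. ?O \<sigma> = {}) \<and> (\<exists>w. ?O \<tau> = {w})"
    then obtain w where w: "?O \<tau> = {w}" by blast
    have "?M = ?O \<tau>" using * M \<tau> by blast
    then show "\<exists>w. ?M = {w} \<and> order_iso w \<tau>" using w by auto
  next
    assume "\<exists>w. ?M = {w} \<and> order_iso w \<tau>"
    then obtain w where w: "?M = {w}" "order_iso w \<tau>" by blast
    have sub: "?O \<sigma> \<subseteq> {w}" if "\<sigma> \<in> perms_first k 1" for \<sigma> using that M w(1) by blast
    have "w \<in> ?O \<tau>" using w M by blast
    then have "?O \<tau> = {w}" using sub[OF \<tau>] by blast
    moreover have "?O \<sigma> = {}" if "\<sigma> \<in> perms_first k 1 - {\<tau>}" for \<sigma>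
      using sub[of \<sigma>] that order_iso_perms_unique[OF _ \<tau> _ w(2), of \<sigma>] by blast
    ultimately show "(\<forall>\<sigma> \<in> perms_first k 1 - {\<tau>}. ?O \<sigma> = {}) \<and> (\<exists>w. ?O \<tau> = {w})" by blast
  qed
  then show ?thesis
    unfolding led_once_def contains_exactly_once_iff[OF assms(1)] avoids_iff[OF assms(1)] by auto
qed

section \<open>The cardinality\<close>

text \<open>
  For the pattern of length one, every entry on its own is an occurrence.
\<close>

lemma led_once_singleton: "led_once [t] xs \<longleftrightarrow> (\<exists>a. set xs = {a})"
proof -
  have "min_led 0 xs = (\<lambda>a. [a]) ` set xs"
    by (auto simp: min_led_def length_Suc_conv subseq_singleton_left)
  moreover have "(\<lambda>a. [a]) ` set xs = {w} \<longleftrightarrow> (\<exists>a. w = [a] \<and> set xs = {a})" for w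
  proof
    assume w: "(\<lambda>a. [a]) ` set xs = {w}"
    then have "w \<in> (\<lambda>a. [a]) ` set xs" by simp
    then obtain a where "w = [a]" "a \<in> set xs" by auto
    moreover have "b = a" if "b \<in> set xs" for b
      using imageI[OF that, of "\<lambda>a. [a]"] unfolding w \<open>w = [a]\<close> by simp
    ultimately show "\<exists>a. w = [a] \<and> set xs = {a}" by blast
  qed auto
  ultimately show ?thesis by (auto simp: led_once_def order_iso_def)
qed

theorem theorem3p1:
  fixes k n :: nat and \<tau> :: "nat list"
  assumes "1 \<le> k" and "k \<le> n" and "\<tau> \<in> perms_first k 1"
  shows "card (perms_avoiding_once n (perms_first k 1) \<tau>) = (n + 1 - k) * (k - 1) ^ (n - k)"
proof -
  have set: "perms_avoiding_once n (perms_first k 1) \<tau> = {\<alpha> \<in> permutations_of_set {1..n}. led_once \<tau> \<alpha>}"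
    using avoiding_once_iff_led_once[OF _ assms(3)]
    by (auto simp: perms_avoiding_once_def perms_def permutations_of_set_def)
  obtain ts where ts: "\<tau> = 1 # ts" "\<forall>y\<in>set ts. 1 < y" "\<tau> \<in> permutations_of_set {1..k}"
    using assms(3) by (auto simp: perms_first_1_iff)
  have len: "length ts = k - 1" using length_finite_permutations_of_set[OF ts(3)] ts(1) by simp
  show ?thesis
  proof (cases "ts = []")
    case True
    then have "k = 1" using len assms(1) by simp
    have "led_once \<tau> \<alpha> \<longleftrightarrow> n = 1" if "\<alpha> \<in> permutations_of_set {1..n}" for \<alpha>
    proof -
      have "set \<alpha> = {1..n}" using that by (simp add: permutations_of_set_def)
      moreover have "(\<exists>a. {1..n} = {a}) \<longleftrightarrow> n = 1" by auto
      ultimately show ?thesis using True ts(1) by (simp add: led_once_singleton)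
    qed
    then have "{\<alpha> \<in> permutations_of_set {1..n}. led_once \<tau> \<alpha>} = (if n = 1 then {[1]} else {})"
      by auto
    then show ?thesis using \<open>k = 1\<close> assms(2) set by simp
  next
    case False
    moreover have "distinct ts" using ts by (simp add: permutations_of_set_def)
    ultimately have "card {\<alpha> \<in> permutations_of_set {1..n}. led_once \<tau> \<alpha>} =
        (n - length ts) * length ts ^ (n - length ts - 1)"
      using card_led_once[of "{1..n}" ts 1] ts(1,2) by simp
    moreover have "n - (k - 1) = n + 1 - k" "n - (k - 1) - 1 = n - k" using assms(1,2) by auto
    ultimately show ?thesis unfolding set len by simp
  qed
qed

end
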